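(* Let $A\in\mathcal A$ with $\mu(A)>0$, let $r>0$ and let $g\in L_p(S;X)$. Then the metric projection $P_{B_A(r)}:L_p(S;X)\to B_A(r)$ satisfies: (a) $P_{B_A(r)}(g)=g$, for $g\in B_A(r)$; (b) $P_{B_A(r)}(g)=\dfrac{r}{\|g\|_{L_p(A;X)}}\,g$, for $g\in L_p(A;X)\setminus B_A(r)$; (c) $P_{B_A(r)}(g)=g_A$, for $g\in C_A(r)\setminus L_p(A;X)$; (d) $P_{B_A(r)}(g)=\dfrac{r}{\|g_A\|_{L_p(A;X)}}\,g_A$, for $g\in L_p(S;X)\setminus(C_A(r)\cup L_p(A;X))$.
   Context: Let $(S,\mathcal A,\mu)$ be a positive measure space, $X$ a real uniformly convex and uniformly smooth Banach space, and $1<p<\infty$. $L_p(S;X)$ is the Bochner space of ($\mu$-equivalence classes of) strongly measurable $f:S\to X$ with $\|f\|_{L_p(S;X)}=\left(\int_S\|f(s)\|_X^p\,d\mu(s)\right)^{1/p}<\infty$; it is a uniformly convex and uniformly smooth Banach space. For $A\in\mathcal A$ with $\mu(A)>0$, $L_p(A;X)$ is the subspace $\{f\in L_p(S;X): f(s)=\theta \text{ for } \mu\text{-a.e. } s\in S\setminus A\}$ ($\theta$ denotes the zero vector) with the induced norm, denoted $\|\cdot\|_{L_p(A;X)}$. For $f\in L_p(S;X)$, $f_A\in L_p(A;X)$ is defined by $f_A(s)=f(s)$ for $s\in A$ and $f_A(s)=\theta$ for $s\notin A$. For $r>0$, $B_A(r)=\{f\in L_p(A;X):\|f\|_{L_p(A;X)}\le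 r\}$ and $C_A(r)=\{f\in L_p(S;X): f_A\in B_A(r)\}$. For a nonempty closed convex subset $C$ of a uniformly convex and uniformly smooth Banach space $Z$, the metric projection $P_C:Z\to C$ assigns to $x$ the unique point $P_Cx\in C$ with $\|x-P_Cx\|\le\|x-z\|$ for all $z\in C$. *)

theory Defs
  imports "HOL-Analysis.Analysis"
begin

definition uniformly_convex :: "'x::real_normed_vector itself \<Rightarrow> bool" where
  "uniformly_convex _ \<longleftrightarrow>
     (\<forall>\<epsilon>::real. 0 < \<epsilon> \<and> \<epsilon> \<le> 2 \<longrightarrow>
       (\<exists>\<delta>>0. \<forall>x y :: 'x. norm x = 1 \<and> norm y = 1 \<and> norm (x - y) \<ge> \<epsilon> \<longrightarrow>
          norm ((1/2) *\<^sub>R (x + y)) \<le> 1 - \<delta>))"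

definition uniformly_smooth :: "'x::real_normed_vector itself \<Rightarrow> bool" where
  "uniformly_smooth _ \<longleftrightarrow>
     (\<forall>\<epsilon>::real. 0 < \<epsilon> \<longrightarrow>
       (\<exists>\<delta>>0. \<forall>x y :: 'x. norm x = 1 \<and> norm y \<le> \<delta> \<longrightarrow>
          norm (x + y) + norm (x - y) \<le> 2 + \<epsilon> * norm y))"

text \<open>
  The library's Bochner integral and Borel measurability of sums need a second countable codomain,
  so strong measurability of functions into an arbitrary normed space is introduced here. Requiring
  convergence everywhere instead of almost everywhere yields the same equivalence classes, since an
  almost everywhere limit can be set to zero on a measurable null set.
\<close>

definition strongly_measurable :: "'s measure \<Rightarrow> ('s \<Rightarrow> 'x::real_normed_vector) \<Rightarrow> bool" where
  "strongly_measurable M f \<longleftrightarrow>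
     (\<exists>u. (\<forall>i::nat. simple_function M (u i)) \<and>
          (\<forall>s\<in>space M. (\<lambda>i. u i s) \<longlonglongrightarrow> f s))"

definition pow_integral :: "'s measure \<Rightarrow> real \<Rightarrow> ('s \<Rightarrow> 'x::real_normed_vector) \<Rightarrow> ennreal" where
  "pow_integral M p f = (\<integral>\<^sup>+ s. ennreal (norm (f s) powr p) \<partial>M)"

text \<open>
  Elements of the Bochner space \<open>Lp M p\<close> are equivalence classes of functions, taken as a quotient
  of \<open>Lp_fun M p\<close>; operations on classes act on representatives.
\<close>

definition Lp_fun :: "'s measure \<Rightarrow> real \<Rightarrow> ('s \<Rightarrow> 'x::real_normed_vector) set" where
  "Lp_fun M p = {f. strongly_measurable M f \<and> pow_integral M p f < \<infinity>}"

definition Lp_eq :: "'s measure \<Rightarrow> real \<Rightarrow>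
    (('s \<Rightarrow> 'x::real_normed_vector) \<times> ('s \<Rightarrow> 'x)) set" where
  "Lp_eq M p = {(f, h). f \<in> Lp_fun M p \<and> h \<in> Lp_fun M p \<and> (AE s in M. f s = h s)}"

definition Lp :: "'s measure \<Rightarrow> real \<Rightarrow> ('s \<Rightarrow> 'x::real_normed_vector) set set" where
  "Lp M p = Lp_fun M p // Lp_eq M p"

definition Lp_norm :: "'s measure \<Rightarrow> real \<Rightarrow> ('s \<Rightarrow> 'x::real_normed_vector) set \<Rightarrow> real" where
  "Lp_norm M p F = the_elem ((\<lambda>f. enn2real (pow_integral M p f) powr (1 / p)) ` F)"

definition Lp_minus :: "'s measure \<Rightarrow> real \<Rightarrow>
    ('s \<Rightarrow> 'x::real_normed_vector) set \<Rightarrow> ('s \<Rightarrow> 'x) set \<Rightarrow> ('s \<Rightarrow> 'x) set" where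
  "Lp_minus M p F G = (\<Union>f\<in>F. \<Union>g\<in>G. Lp_eq M p `` {\<lambda>s. f s - g s})"

definition Lp_scaleR :: "'s measure \<Rightarrow> real \<Rightarrow> real \<Rightarrow>
    ('s \<Rightarrow> 'x::real_normed_vector) set \<Rightarrow> ('s \<Rightarrow> 'x) set" where
  "Lp_scaleR M p c F = (\<Union>f\<in>F. Lp_eq M p `` {\<lambda>s. c *\<^sub>R f s})"

definition Lp_dist :: "'s measure \<Rightarrow> real \<Rightarrow>
    ('s \<Rightarrow> 'x::real_normed_vector) set \<Rightarrow> ('s \<Rightarrow> 'x) set \<Rightarrow> real" where
  "Lp_dist M p F G = Lp_norm M p (Lp_minus M p F G)"

text \<open>
  \<open>Lp_on M p A\<close> is the subspace $L_p(A;X)$ of $L_p(S;X)$; its norm is the induced one, so \<open>Lp_norm\<close>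
  is used for it as well. \<open>Lp_restrict M p A F\<close> is the class $f_A$.
\<close>

definition Lp_on :: "'s measure \<Rightarrow> real \<Rightarrow> 's set \<Rightarrow> ('s \<Rightarrow> 'x::real_normed_vector) set set" where
  "Lp_on M p A = {F \<in> Lp M p. \<forall>f\<in>F. AE s in M. s \<notin> A \<longrightarrow> f s = 0}"

definition Lp_restrict :: "'s measure \<Rightarrow> real \<Rightarrow> 's set \<Rightarrow>
    ('s \<Rightarrow> 'x::real_normed_vector) set \<Rightarrow> ('s \<Rightarrow> 'x) set" where
  "Lp_restrict M p A F = (\<Union>f\<in>F. Lp_eq M p `` {\<lambda>s. if s \<in> A then f s else 0})"

definition ball_on :: "'s measure \<Rightarrow> real \<Rightarrow> 's set \<Rightarrow> real \<Rightarrow>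
    ('s \<Rightarrow> 'x::real_normed_vector) set set" where
  "ball_on M p A r = {F \<in> Lp_on M p A. Lp_norm M p F \<le> r}"

definition cylinder_on :: "'s measure \<Rightarrow> real \<Rightarrow> 's set \<Rightarrow> real \<Rightarrow>
    ('s \<Rightarrow> 'x::real_normed_vector) set set" where
  "cylinder_on M p A r = {F \<in> Lp M p. Lp_restrict M p A F \<in> ball_on M p A r}"

text \<open>
  The definite description makes existence and uniqueness of the nearest point part of any
  provable equation \<open>metric_projection d C x = c\<close>.
\<close>

definition metric_projection :: "('z \<Rightarrow> 'z \<Rightarrow> real) \<Rightarrow> 'z set \<Rightarrow> 'z \<Rightarrow> 'z" where
  "metric_projection d C x = (THE c. c \<in> C \<and> (\<forall>z\<in>C. d x c \<le> d x z))"

subsection \<open>Independence of representatives\<close>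

lemma equiv_Lp_eq: "equiv (Lp_fun M p) (Lp_eq M p)"
proof (rule equivI)
  show "trans (Lp_eq M p)"
  proof (rule transI)
    fix f g h assume fg: "(f, g) \<in> Lp_eq M p" and gh: "(g, h) \<in> Lp_eq M p"
    have "AE s in M. f s = g s" "AE s in M. g s = h s"
      using fg gh by (simp_all add: Lp_eq_def)
    then have "AE s in M. f s = h s" by eventually_elim simp
    then show "(f, h) \<in> Lp_eq M p" using fg gh by (simp add: Lp_eq_def)
  qed
  show "sym (Lp_eq M p)"
  proof (rule symI)
    fix f g assume fg: "(f, g) \<in> Lp_eq M p"
    have "AE s in M. f s = g s" using fg by (simp add: Lp_eq_def)
    then have "AE s in M. g s = f s" by eventually_elim simp
    then show "(g, f) \<in> Lp_eq M p" using fg by (simp add: Lp_eq_def)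
  qed
qed (auto simp: Lp_eq_def refl_on_def)

lemma Lp_norm_class:
  assumes "f \<in> Lp_fun M p"
  shows "Lp_norm M p (Lp_eq M p `` {f}) = enn2real (pow_integral M p f) powr (1 / p)"
proof -
  have "pow_integral M p h = pow_integral M p f" if "h \<in> Lp_eq M p `` {f}" for h
  proof -
    have "AE s in M. f s = h s" using that by (simp add: Lp_eq_def)
    then have "AE s in M. ennreal (norm (h s) powr p) = ennreal (norm (f s) powr p)"
      by eventually_elim simp
    then show ?thesis unfolding pow_integral_def by (rule nn_integral_cong_AE)
  qed
  moreover have "f \<in> Lp_eq M p `` {f}" using assms by (simp add: Lp_eq_def)
  ultimately have "(\<lambda>f. enn2real (pow_integral M p f) powr (1 / p)) ` (Lp_eq M p `` {f})
      = {enn2real (pow_integral M p f) powr (1 / p)}"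
    by (metis (no_types, lifting) image_cong image_constant)
  then show ?thesis unfolding Lp_norm_def by simp
qed

lemma strongly_measurable_diff:
  assumes "strongly_measurable M f" "strongly_measurable M g"
  shows "strongly_measurable M (\<lambda>s. f s - g s)"
proof -
  obtain u where "\<forall>i. simple_function M (u i)" "\<forall>s\<in>space M. (\<lambda>i. u i s) \<longlonglongrightarrow> f s"
    using assms(1) unfolding strongly_measurable_def by blast
  moreover obtain v where "\<forall>i. simple_function M (v i)" "\<forall>s\<in>space M. (\<lambda>i. v i s) \<longlonglongrightarrow> g s"
    using assms(2) unfolding strongly_measurable_def by blast
  ultimately show ?thesis unfolding strongly_measurable_def
    by (intro exI[of _ "\<lambda>i s. u i s - v i s"])
       (auto intro!: tendsto_diff simple_function_compose2[where h = "(-)"])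
qed

lemma strongly_measurable_norm:
  assumes "strongly_measurable M f"
  shows "(\<lambda>s. norm (f s)) \<in> borel_measurable M"
proof -
  obtain u where u: "\<forall>i. simple_function M (u i)" "\<forall>s\<in>space M. (\<lambda>i. u i s) \<longlonglongrightarrow> f s"
    using assms unfolding strongly_measurable_def by blast
  show ?thesis
  proof (rule borel_measurable_LIMSEQ_real)
    show "(\<lambda>s. norm (u i s)) \<in> borel_measurable M" for i
      using u simple_function_compose1[of M "u i" norm]
      by (auto intro: borel_measurable_simple_function)
  qed (use u in \<open>auto intro: tendsto_norm\<close>)
qed

lemma strongly_measurable_scaleR:
  assumes "strongly_measurable M f"
  shows "strongly_measurable M (\<lambda>s. c *\<^sub>R f s)"
proof -
  obtain u where "\<forall>i. simple_function M (u i)" "\<forall>s\<in>space M. (\<lambda>i. u i s) \<longlonglongrightarrow> f s"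
    using assms unfolding strongly_measurable_def by blast
  then show ?thesis unfolding strongly_measurable_def
    by (intro exI[of _ "\<lambda>i s. c *\<^sub>R u i s"])
       (auto intro!: tendsto_intros simple_function_compose1[where g = "(*\<^sub>R) c"])
qed

lemma strongly_measurable_restrict:
  assumes "A \<in> sets M" "strongly_measurable M f"
  shows "strongly_measurable M (\<lambda>s. if s \<in> A then f s else 0)"
proof -
  obtain u where u: "\<forall>i. simple_function M (u i)" "\<forall>s\<in>space M. (\<lambda>i. u i s) \<longlonglongrightarrow> f s"
    using assms unfolding strongly_measurable_def by blast
  show ?thesis unfolding strongly_measurable_def
    by (rule exI[of _ "\<lambda>i s. if s \<in> A then u i s else 0"])
       (use u assms sets.sets_into_space in
         \<open>auto intro!: simple_function_If_set simp: Int_absorb2\<close>)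
qed

lemma Lp_fun_diff:
  assumes "1 < p" "f \<in> Lp_fun M p" "g \<in> Lp_fun M p"
  shows "(\<lambda>s. f s - g s) \<in> Lp_fun M p"
proof -
  have sm: "strongly_measurable M f" "strongly_measurable M g"
    and fin: "pow_integral M p f < \<infinity>" "pow_integral M p g < \<infinity>"
    using assms by (auto simp: Lp_fun_def)
  have [measurable]: "(\<lambda>s. norm (f s)) \<in> borel_measurable M" "(\<lambda>s. norm (g s)) \<in> borel_measurable M"
    using sm by (auto intro: strongly_measurable_norm)
  have le: "norm (x - y) powr p \<le> 2 powr p * norm x powr p + 2 powr p * norm y powr p"
    for x y :: 'b
  proof -
    have "norm (x - y) powr p \<le> (2 * max (norm x) (norm y)) powr p"
      using assms norm_triangle_ineq4[of x y] by (intro powr_mono2) auto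
    also have "\<dots> = 2 powr p * max (norm x) (norm y) powr p"
      by (simp add: powr_mult)
    also have "\<dots> \<le> 2 powr p * norm x powr p + 2 powr p * norm y powr p"
      by (auto simp: max_def)
    finally show ?thesis .
  qed
  have "pow_integral M p (\<lambda>s. f s - g s)
      \<le> (\<integral>\<^sup>+ s. ennreal (2 powr p) * ennreal (norm (f s) powr p)
            + ennreal (2 powr p) * ennreal (norm (g s) powr p) \<partial>M)"
    unfolding pow_integral_def
    by (intro nn_integral_mono)
       (simp add: le ennreal_mult'[symmetric] ennreal_plus[symmetric] del: ennreal_plus)
  also have "\<dots> = ennreal (2 powr p) * pow_integral M p f + ennreal (2 powr p) * pow_integral M p g"
    unfolding pow_integral_def by (simp add: nn_integral_add nn_integral_cmult)
  also have "\<dots> < \<infinity>" using fin by (simp add: ennreal_mult_less_top)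
  finally show ?thesis
    using sm strongly_measurable_diff by (auto simp: Lp_fun_def)
qed

lemma Lp_fun_scaleR:
  assumes "f \<in> Lp_fun M p"
  shows "(\<lambda>s. c *\<^sub>R f s) \<in> Lp_fun M p"
proof -
  have sm: "strongly_measurable M f" and fin: "pow_integral M p f < \<infinity>"
    using assms by (auto simp: Lp_fun_def)
  have [measurable]: "(\<lambda>s. norm (f s)) \<in> borel_measurable M"
    using sm by (rule strongly_measurable_norm)
  have "pow_integral M p (\<lambda>s. c *\<^sub>R f s) = ennreal (\<bar>c\<bar> powr p) * pow_integral M p f"
    unfolding pow_integral_def by (simp add: powr_mult ennreal_mult' nn_integral_cmult)
  then show ?thesis
    using sm fin strongly_measurable_scaleR by (auto simp: Lp_fun_def ennreal_mult_less_top)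
qed

lemma Lp_fun_restrict:
  assumes "A \<in> sets M" "f \<in> Lp_fun M p"
  shows "(\<lambda>s. if s \<in> A then f s else 0) \<in> Lp_fun M p"
proof -
  have "pow_integral M p (\<lambda>s. if s \<in> A then f s else 0) \<le> pow_integral M p f"
    unfolding pow_integral_def by (intro nn_integral_mono) auto
  then show ?thesis
    using assms strongly_measurable_restrict by (auto simp: Lp_fun_def)
qed

lemma Lp_eq_class_eqI:
  assumes "f \<in> Lp_fun M p" "h \<in> Lp_fun M p" "AE s in M. f s = h s"
  shows "Lp_eq M p `` {f} = Lp_eq M p `` {h}"
  using equiv_class_eq[OF equiv_Lp_eq] assms by (auto simp: Lp_eq_def)

lemma Lp_minus_class:
  assumes "1 < p" "f \<in> Lp_fun M p" "g \<in> Lp_fun M p"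
  shows "Lp_minus M p (Lp_eq M p `` {f}) (Lp_eq M p `` {g}) = Lp_eq M p `` {\<lambda>s. f s - g s}"
proof -
  have "Lp_eq M p `` {\<lambda>s. f' s - g' s} = Lp_eq M p `` {\<lambda>s. f s - g s}"
    if "(f, f') \<in> Lp_eq M p" "(g, g') \<in> Lp_eq M p" for f' g'
  proof (rule Lp_eq_class_eqI)
    have "AE s in M. f s = f' s" "AE s in M. g s = g' s"
      using that by (simp_all add: Lp_eq_def)
    then show "AE s in M. f' s - g' s = f s - g s" by eventually_elim simp
  qed (use that assms(1) in \<open>simp_all add: Lp_eq_def Lp_fun_diff\<close>)
  moreover have "f \<in> Lp_eq M p `` {f}" "g \<in> Lp_eq M p `` {g}"
    using assms by (auto simp: Lp_eq_def)
  ultimately show ?thesis unfolding Lp_minus_def by blast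
qed

lemma Lp_scaleR_class:
  assumes "f \<in> Lp_fun M p"
  shows "Lp_scaleR M p c (Lp_eq M p `` {f}) = Lp_eq M p `` {\<lambda>s. c *\<^sub>R f s}"
proof -
  have "Lp_eq M p `` {\<lambda>s. c *\<^sub>R f' s} = Lp_eq M p `` {\<lambda>s. c *\<^sub>R f s}"
    if "(f, f') \<in> Lp_eq M p" for f'
  proof (rule Lp_eq_class_eqI)
    have "AE s in M. f s = f' s"
      using that by (simp add: Lp_eq_def)
    then show "AE s in M. c *\<^sub>R f' s = c *\<^sub>R f s" by eventually_elim simp
  qed (use that in \<open>simp_all add: Lp_eq_def Lp_fun_scaleR\<close>)
  moreover have "f \<in> Lp_eq M p `` {f}"
    using assms by (auto simp: Lp_eq_def)
  ultimately show ?thesis unfolding Lp_scaleR_def by blast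
qed

lemma Lp_restrict_class:
  assumes "A \<in> sets M" "f \<in> Lp_fun M p"
  shows "Lp_restrict M p A (Lp_eq M p `` {f}) = Lp_eq M p `` {\<lambda>s. if s \<in> A then f s else 0}"
proof -
  have "Lp_eq M p `` {\<lambda>s. if s \<in> A then f' s else 0} = Lp_eq M p `` {\<lambda>s. if s \<in> A then f s else 0}"
    if "(f, f') \<in> Lp_eq M p" for f'
  proof (rule Lp_eq_class_eqI)
    have "AE s in M. f s = f' s"
      using that by (simp add: Lp_eq_def)
    then show "AE s in M. (if s \<in> A then f' s else 0) = (if s \<in> A then f s else 0)"
      by eventually_elim simp
  qed (use that assms(1) in \<open>simp_all add: Lp_eq_def Lp_fun_restrict\<close>)
  moreover have "f \<in> Lp_eq M p `` {f}"
    using assms by (auto simp: Lp_eq_def)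
  ultimately show ?thesis unfolding Lp_restrict_def by blast
qed

end

theory Submission
  imports Defs
begin

text \<open>
  On functions vanishing off \<open>A\<close> the \<open>p\<close>-th power of the distance to \<open>f\<close> splits as
  \<open>\<parallel>f - f\<^sub>A\<parallel>\<^sup>p + \<parallel>f\<^sub>A - z\<parallel>\<^sup>p\<close>, so only the second term matters. If \<open>\<parallel>f\<^sub>A\<parallel> > r\<close>, put
  \<open>t = r / \<parallel>f\<^sub>A\<parallel>\<close> and write \<open>f\<^sub>A = t (z / t) + (1 - t) ((f\<^sub>A - z) / (1 - t))\<close>; integrating the convexity
  inequality of \<open>\<parallel>\<cdot>\<parallel>\<^sup>p\<close> at this combination gives \<open>\<parallel>f\<^sub>A - z\<parallel> \<ge> (1 - t) \<parallel>f\<^sub>A\<parallel>\<close> whenever \<open>\<parallel>z\<parallel> \<le> r\<close>.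
  Equality forces pointwise equality almost everywhere, and strict convexity of \<open>X\<close> and of the
  \<open>p\<close>-th power then yields \<open>z = t f\<^sub>A\<close>.
\<close>

section \<open>Strict convexity of the real power function\<close>

text \<open>Strict Bernoulli inequality: x^p - p x decreases on (0, 1) and increases beyond 1, so
  its minimum at 1 is strict. The point 0 is separate because the derivative formula is stated for
  positive x.\<close>

lemma one_plus_less_powr:
  fixes w p :: real
  assumes "0 \<le> w" "w \<noteq> 1" "1 < p"
  shows "1 + p * (w - 1) < w powr p"
proof (cases "w = 0")
  case True
  then show ?thesis using assms by simp
next
  case False
  define h where "h x = x powr p - p * x" for x :: real
  have deriv: "(h has_real_derivative p * (x powr (p - 1) - 1)) (at x)" if "0 < x" for x
    unfolding h_def using that by (auto intro!: derivative_eq_intros simp: algebra_simps)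
  have cont: "isCont h x" if "0 < x" for x
    using deriv[OF that] by (rule DERIV_isCont)
  have "h 1 < h w"
  proof (cases "w < 1")
    case True
    show ?thesis
    proof (rule DERIV_neg_imp_decreasing_open[OF True])
      show "\<exists>y. (h has_real_derivative y) (at x) \<and> y < 0" if "w < x" "x < 1" for x
        using that assms False deriv[of x] powr_less_mono2[of "p - 1" x 1]
        by (intro exI[of _ "p * (x powr (p - 1) - 1)"]) (auto simp: mult_less_0_iff)
    qed (use assms False cont in \<open>auto intro!: continuous_at_imp_continuous_on\<close>)
  next
    case 2: False
    have "1 < w" using 2 assms by simp
    then show ?thesis
    proof (rule DERIV_pos_imp_increasing_open)
      show "\<exists>y. (h has_real_derivative y) (at x) \<and> 0 < y" if "1 < x" "x < w" for x
        using that assms deriv[of x] powr_less_mono2[of "p - 1" 1 x]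
        by (intro exI[of _ "p * (x powr (p - 1) - 1)"]) auto
    qed (use cont in \<open>auto intro!: continuous_at_imp_continuous_on\<close>)
  qed
  then show ?thesis by (simp add: h_def algebra_simps)
qed

text \<open>By homogeneity the tangent at \<open>m\<close> is the tangent at 1, taken at w = x / m
  and multiplied by \<open>m powr p\<close>.\<close>

lemma powr_tangent_le:
  fixes x m p :: real
  assumes "0 \<le> x" "0 < m" "1 < p"
  shows "m powr p + p * m powr (p - 1) * (x - m) \<le> x powr p"
    and "x \<noteq> m \<Longrightarrow> m powr p + p * m powr (p - 1) * (x - m) < x powr p"
proof -
  have eq: "m powr p + p * m powr (p - 1) * (x - m) = m powr p * (1 + p * (x / m - 1))"
    using assms by (simp add: powr_diff field_simps)
  have x: "x powr p = m powr p * (x / m) powr p"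
    using assms by (simp add: powr_mult[symmetric])
  show *: "m powr p + p * m powr (p - 1) * (x - m) < x powr p" if "x \<noteq> m"
    unfolding eq x using that assms one_plus_less_powr[of "x / m" p] by simp
  show "m powr p + p * m powr (p - 1) * (x - m) \<le> x powr p"
    using * by (cases "x = m") auto
qed

text \<open>Both values are compared with the tangent at the mean \<open>m\<close>: in the weighted
  sum the linear terms cancel and \<open>m powr p\<close> remains. Distinct \<open>x\<close> and
  \<open>y\<close> make \<open>m\<close> positive and different from \<open>x\<close>, so the bound
  at \<open>x\<close> is strict.\<close>

lemma powr_strict_convex:
  fixes x y t p :: real
  assumes "0 \<le> x" "0 \<le> y" "0 < t" "t < 1" "1 < p"
  shows "(t * x + (1 - t) * y) powr p \<le> t * x powr p + (1 - t) * y powr p"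
    and "(t * x + (1 - t) * y) powr p = t * x powr p + (1 - t) * y powr p \<Longrightarrow> x = y"
proof -
  define m where "m = t * x + (1 - t) * y"
  have tangent: "m powr p = t * (m powr p + p * m powr (p - 1) * (x - m))
      + (1 - t) * (m powr p + p * m powr (p - 1) * (y - m))"
    by (simp add: m_def algebra_simps)
  have strict: "m powr p < t * x powr p + (1 - t) * y powr p" if "x \<noteq> y"
  proof -
    have "0 < x \<or> 0 < y" using that assms by auto
    then have m: "0 < m"
      unfolding m_def using assms by (auto intro: add_pos_nonneg add_nonneg_pos)
    have "x \<noteq> m"
    proof
      assume "x = m"
      then have "(1 - t) * (x - y) = 0" by (simp add: m_def algebra_simps)
      then show False using that assms by simp
    qed
    then have "t * (m powr p + p * m powr (p - 1) * (x - m)) < t * x powr p"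
      using powr_tangent_le(2)[OF _ m] assms by simp
    moreover have "(1 - t) * (m powr p + p * m powr (p - 1) * (y - m)) \<le> (1 - t) * y powr p"
      using powr_tangent_le(1)[OF _ m] assms by simp
    ultimately show ?thesis using tangent by linarith
  qed
  show "(t * x + (1 - t) * y) powr p = t * x powr p + (1 - t) * y powr p \<Longrightarrow> x = y"
    using strict unfolding m_def by auto
  show "(t * x + (1 - t) * y) powr p \<le> t * x powr p + (1 - t) * y powr p"
    using strict unfolding m_def by (cases "x = y") (auto simp: algebra_simps)
qed

section \<open>Strict convexity of the norm\<close>

text \<open>Uniform convexity is applied with \<epsilon> = \<open>norm (u - v)\<close>, which the
  triangle inequality keeps in (0, 2].\<close>

lemma uniformly_convex_midpoint:
  fixes u v :: "'x::real_normed_vector"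
  assumes "uniformly_convex TYPE('x)" "norm u = 1" "norm v = 1" "u \<noteq> v"
  shows "norm ((1/2) *\<^sub>R (u + v)) < 1"
proof -
  have "0 < norm (u - v)" "norm (u - v) \<le> 2"
    using assms norm_triangle_ineq4[of u v] by auto
  then obtain \<delta> where "\<delta> > 0" "norm ((1/2) *\<^sub>R (u + v)) \<le> 1 - \<delta>"
    using assms unfolding uniformly_convex_def by (metis order_refl)
  then show ?thesis by linarith
qed

text \<open>For t at most 1/2 the point combines the midpoint and \<open>v\<close> with weights 2t
  and 1 - 2t, so a midpoint of norm below 1 pulls it below 1 too. Larger t follow by exchanging
  \<open>u\<close> and \<open>v\<close>.\<close>

lemma uniformly_convex_unit_segment:
  fixes u v :: "'x::real_normed_vector"
  assumes "uniformly_convex TYPE('x)" "0 < t" "t < 1" "norm u = 1" "norm v = 1"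
    and "norm (t *\<^sub>R u + (1 - t) *\<^sub>R v) = 1"
  shows "u = v"
proof -
  have half: "u = v"
    if "0 < t" "t \<le> 1/2" "norm u = 1" "norm v = 1" "norm (t *\<^sub>R u + (1 - t) *\<^sub>R v) = 1"
    for t and u v :: 'x
  proof (rule ccontr)
    assume "u \<noteq> v"
    then have mid: "norm ((1/2) *\<^sub>R (u + v)) < 1"
      using uniformly_convex_midpoint assms(1) that by blast
    have "t *\<^sub>R u + (1 - t) *\<^sub>R v = (2 * t) *\<^sub>R ((1/2) *\<^sub>R (u + v)) + (1 - 2 * t) *\<^sub>R v"
      by (simp add: algebra_simps flip: scaleR_2)
    then have "1 \<le> norm ((2 * t) *\<^sub>R ((1/2) *\<^sub>R (u + v))) + norm ((1 - 2 * t) *\<^sub>R v)"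
      using that norm_triangle_ineq by metis
    also have "\<dots> = 2 * t * norm ((1/2) *\<^sub>R (u + v)) + (1 - 2 * t)"
      using that by simp
    also have "\<dots> < 2 * t * 1 + (1 - 2 * t)"
      using mid that by (intro add_strict_right_mono mult_strict_left_mono) auto
    finally show False by simp
  qed
  show ?thesis
  proof (cases "t \<le> 1/2")
    case True
    then show ?thesis using half assms by blast
  next
    case False
    then show ?thesis
      using half[of "1 - t" v u] assms by (simp add: add.commute)
  qed
qed

text \<open>Dividing by the common norm, unless it is zero, moves both vectors to the unit
  sphere.\<close>

lemma uniformly_convex_segment:
  fixes u v :: "'x::real_normed_vector"
  assumes uc: "uniformly_convex TYPE('x)" and t: "0 < t" "t < 1"
    and uv: "norm u = norm v" and eq: "norm (t *\<^sub>R u + (1 - t) *\<^sub>R v) = norm v"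
  shows "u = v"
proof (cases "v = 0")
  case True
  then show ?thesis using uv by simp
next
  case False
  define a where "a = inverse (norm v)"
  have a: "a > 0" "a * norm v = 1" using False by (auto simp: a_def)
  have "t *\<^sub>R (a *\<^sub>R u) + (1 - t) *\<^sub>R (a *\<^sub>R v) = a *\<^sub>R (t *\<^sub>R u + (1 - t) *\<^sub>R v)"
    by (simp add: algebra_simps)
  then have "norm (t *\<^sub>R (a *\<^sub>R u) + (1 - t) *\<^sub>R (a *\<^sub>R v)) = a * norm v"
    using a eq by simp
  moreover have "norm (a *\<^sub>R u) = 1" "norm (a *\<^sub>R v) = 1"
    using a uv by simp_all
  ultimately have "a *\<^sub>R u = a *\<^sub>R v"
    using uniformly_convex_unit_segment[OF uc t] a(2) by metis
  then show ?thesis using a by simp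
qed

text \<open>The factor \<open>t powr (1 - p)\<close> is what remains of
  \<open>t * norm (z /\<^sub>R t) powr p\<close>, and likewise for 1 - t. Equality must pass through
  both the convexity of the power and the triangle inequality: the first gives \<open>u\<close> and
  \<open>v\<close> equal norms, and then strict convexity of the norm gives u = v = x.\<close>

lemma norm_powr_split:
  fixes x z :: "'x::real_normed_vector"
  assumes t: "0 < t" "t < 1" and p: "1 < p"
  shows "norm x powr p \<le> t powr (1 - p) * norm z powr p + (1 - t) powr (1 - p) * norm (x - z) powr p"
    and "uniformly_convex TYPE('x) \<Longrightarrow>
      norm x powr p = t powr (1 - p) * norm z powr p + (1 - t) powr (1 - p) * norm (x - z) powr p
      \<Longrightarrow> z = t *\<^sub>R x"
proof -
  define u where "u = z /\<^sub>R t"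
  define v where "v = (x - z) /\<^sub>R (1 - t)"
  have x: "t *\<^sub>R u + (1 - t) *\<^sub>R v = x" and z: "z = t *\<^sub>R u"
    using t by (simp_all add: u_def v_def)
  have scale: "a * norm (y /\<^sub>R a) powr p = a powr (1 - p) * norm y powr p"
    if "0 < a" for a and y :: 'x
    using that by (simp add: powr_mult powr_diff inverse_powr powr_minus divide_inverse)
  have rhs: "t powr (1 - p) * norm z powr p + (1 - t) powr (1 - p) * norm (x - z) powr p
      = t * norm u powr p + (1 - t) * norm v powr p"
    using t scale[of t z] scale[of "1 - t" "x - z"] by (simp add: u_def v_def)
  have tri: "norm x \<le> t * norm u + (1 - t) * norm v"
    using t norm_triangle_ineq[of "t *\<^sub>R u" "(1 - t) *\<^sub>R v"] x by simp
  then have le1: "norm x powr p \<le> (t * norm u + (1 - t) * norm v) powr p"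
    using p by (intro powr_mono2) auto
  note conv = powr_strict_convex[OF norm_ge_zero norm_ge_zero t p, of u v]
  show "norm x powr p
      \<le> t powr (1 - p) * norm z powr p + (1 - t) powr (1 - p) * norm (x - z) powr p"
    using le1 conv(1) rhs by linarith
  show "z = t *\<^sub>R x" if uc: "uniformly_convex TYPE('x)"
    and eq: "norm x powr p
      = t powr (1 - p) * norm z powr p + (1 - t) powr (1 - p) * norm (x - z) powr p"
  proof -
    have uv: "norm u = norm v"
      using le1 conv eq rhs by linarith
    then have "norm x powr p = norm v powr p"
      using eq rhs by (simp add: algebra_simps)
    then have "norm x = norm v"
      using p powr_less_mono2[of p "norm x" "norm v"] powr_less_mono2[of p "norm v" "norm x"]
      by (cases "norm x" "norm v" rule: linorder_cases) auto
    then have "u = v"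
      using uniformly_convex_segment[OF uc t uv] x by simp
    then have "x = u" using x by (simp add: algebra_simps)
    then show ?thesis using z by simp
  qed
qed

section \<open>Classes and integrals of p-th powers\<close>

text \<open>Finiteness of the extended integral allows real integrals, which can be subtracted and
  split by linearity.\<close>

lemma Lp_fun_integrable:
  assumes "f \<in> Lp_fun M p"
  shows "integrable M (\<lambda>s. norm (f s) powr p)"
    and "enn2real (pow_integral M p f) = (LINT s|M. norm (f s) powr p)"
proof -
  have [measurable]: "(\<lambda>s. norm (f s)) \<in> borel_measurable M"
    using assms by (auto simp: Lp_fun_def intro: strongly_measurable_norm)
  show "integrable M (\<lambda>s. norm (f s) powr p)"
    using assms by (intro integrableI_nonneg) (auto simp: Lp_fun_def pow_integral_def)
  show "enn2real (pow_integral M p f) = (LINT s|M. norm (f s) powr p)"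
    unfolding pow_integral_def by (subst integral_eq_nn_integral) auto
qed

lemma Lp_dist_class:
  assumes "1 < p" "f \<in> Lp_fun M p" "h \<in> Lp_fun M p"
  shows "Lp_dist M p (Lp_eq M p `` {f}) (Lp_eq M p `` {h})
    = (LINT s|M. norm (f s - h s) powr p) powr (1 / p)"
  using assms
  by (simp add: Lp_dist_def Lp_minus_class Lp_norm_class Lp_fun_diff Lp_fun_integrable(2))

lemma class_in_Lp: "f \<in> Lp_fun M p \<Longrightarrow> Lp_eq M p `` {f} \<in> Lp M p"
  by (simp add: Lp_def quotientI)

text \<open>The condition in \<open>Lp_on\<close> runs over all representatives; they agree almost
  everywhere, so one of them decides it.\<close>

lemma class_in_Lp_on_iff:
  assumes "f \<in> Lp_fun M p"
  shows "Lp_eq M p `` {f} \<in> Lp_on M p A \<longleftrightarrow> (AE s in M. s \<notin> A \<longrightarrow> f s = 0)"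
proof
  assume "Lp_eq M p `` {f} \<in> Lp_on M p A"
  moreover have "f \<in> Lp_eq M p `` {f}" using assms by (simp add: Lp_eq_def)
  ultimately show "AE s in M. s \<notin> A \<longrightarrow> f s = 0" by (auto simp: Lp_on_def)
next
  assume 0: "AE s in M. s \<notin> A \<longrightarrow> f s = 0"
  have "AE s in M. s \<notin> A \<longrightarrow> h s = 0" if "h \<in> Lp_eq M p `` {f}" for h
  proof -
    have "AE s in M. f s = h s" using that by (simp add: Lp_eq_def)
    with 0 show ?thesis by eventually_elim simp
  qed
  then show "Lp_eq M p `` {f} \<in> Lp_on M p A"
    using class_in_Lp[OF assms] by (auto simp: Lp_on_def)
qed

text \<open>Turns a bound on a norm into one on the integral of p-th powers, and yields monotonicity
  of the p-th root.\<close>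

lemma powr_inverse_le_iff:
  fixes x r p :: real
  assumes "0 \<le> x" "0 \<le> r" "0 < p"
  shows "x powr (1 / p) \<le> r \<longleftrightarrow> x \<le> r powr p"
proof
  assume "x powr (1 / p) \<le> r"
  then have "(x powr (1 / p)) powr p \<le> r powr p"
    using assms by (intro powr_mono2) auto
  then show "x \<le> r powr p" using assms by (simp add: powr_powr)
next
  assume "x \<le> r powr p"
  then have "x powr (1 / p) \<le> (r powr p) powr (1 / p)"
    using assms by (intro powr_mono2) auto
  then show "x powr (1 / p) \<le> r" using assms by (simp add: powr_powr)
qed

lemma class_in_ball_on_iff:
  assumes "1 < p" "0 < r" "f \<in> Lp_fun M p"
  shows "Lp_eq M p `` {f} \<in> ball_on M p A r \<longleftrightarrow>
    (AE s in M. s \<notin> A \<longrightarrow> f s = 0) \<and> (LINT s|M. norm (f s) powr p) \<le> r powr p"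
  using assms
  by (simp add: ball_on_def class_in_Lp_on_iff Lp_norm_class Lp_fun_integrable(2)
      powr_inverse_le_iff)

section \<open>The integrated inequality and its equality case\<close>

text \<open>Integrating \<open>norm_powr_split\<close> bounds \<open>F\<close> by a term in
  \<open>Z\<close> plus a term in \<open>D\<close>. The hypothesis on \<open>z\<close> makes the
  first at most t F, so the second is at least (1 - t) F. In the extremal case the pointwise slack
  \<open>gap\<close> integrates to zero, hence vanishes almost everywhere, and the pointwise
  equality case applies.\<close>

lemma scaled_segment_nearest:
  fixes f z :: "'s \<Rightarrow> 'x::real_normed_vector"
  assumes t: "0 < t" "t < 1" and p: "1 < p"
    and f: "f \<in> Lp_fun M p" and z: "z \<in> Lp_fun M p"
    and zle: "(LINT s|M. norm (z s) powr p) \<le> t powr p * (LINT s|M. norm (f s) powr p)"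
  shows "(1 - t) powr p * (LINT s|M. norm (f s) powr p) \<le> (LINT s|M. norm (f s - z s) powr p)"
    and "uniformly_convex TYPE('x) \<Longrightarrow>
      (LINT s|M. norm (f s - z s) powr p) \<le> (1 - t) powr p * (LINT s|M. norm (f s) powr p)
      \<Longrightarrow> AE s in M. z s = t *\<^sub>R f s"
proof -
  define F where "F = (LINT s|M. norm (f s) powr p)"
  define Z where "Z = (LINT s|M. norm (z s) powr p)"
  define D where "D = (LINT s|M. norm (f s - z s) powr p)"
  define gap where "gap s = t powr (1 - p) * norm (z s) powr p
    + (1 - t) powr (1 - p) * norm (f s - z s) powr p - norm (f s) powr p" for s
  note [simp] = Lp_fun_integrable(1)[OF f] Lp_fun_integrable(1)[OF z]
    Lp_fun_integrable(1)[OF Lp_fun_diff[OF p f z]]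
  have gap_int: "integrable M gap" unfolding gap_def by simp
  have gap_nonneg: "0 \<le> gap s" for s
    using norm_powr_split(1)[OF t p, of "f s" "z s"] by (simp add: gap_def)
  have gap_eq: "(LINT s|M. gap s) = t powr (1 - p) * Z + (1 - t) powr (1 - p) * D - F"
    unfolding gap_def F_def Z_def D_def by simp
  have cancel: "a powr (1 - p) * (a powr p * F) = a * F" if "0 < a" for a
    using that by (simp add: powr_diff)
  have "t powr (1 - p) * Z \<le> t powr (1 - p) * (t powr p * F)"
    using zle by (intro mult_left_mono) (auto simp: F_def Z_def)
  then have Zt: "t powr (1 - p) * Z \<le> t * F" using cancel t by simp
  have "0 \<le> (LINT s|M. gap s)" using gap_nonneg by simp
  then have "(1 - t) * F \<le> (1 - t) powr (1 - p) * D"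
    using gap_eq Zt by (simp add: algebra_simps)
  \<comment> \<open>Writing (1 - t) F in this form exposes a common positive factor to
    cancel.\<close>
  then have "(1 - t) powr (1 - p) * ((1 - t) powr p * F) \<le> (1 - t) powr (1 - p) * D"
    using cancel[of "1 - t"] t by (metis diff_gt_0_iff_gt)
  then show "(1 - t) powr p * (LINT s|M. norm (f s) powr p) \<le> (LINT s|M. norm (f s - z s) powr p)"
    using t by (subst (asm) mult_le_cancel_left_pos) (auto simp: F_def D_def)
  show "AE s in M. z s = t *\<^sub>R f s" if uc: "uniformly_convex TYPE('x)"
    and le: "(LINT s|M. norm (f s - z s) powr p) \<le> (1 - t) powr p * (LINT s|M. norm (f s) powr p)"
  proof -
    have "(1 - t) powr (1 - p) * D \<le> (1 - t) powr (1 - p) * ((1 - t) powr p * F)"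
      using le by (intro mult_left_mono) (auto simp: F_def D_def)
    then have "(1 - t) powr (1 - p) * D \<le> (1 - t) * F"
      using cancel[of "1 - t"] t by (metis diff_gt_0_iff_gt)
    then have "(LINT s|M. gap s) = 0"
      using gap_eq Zt \<open>0 \<le> (LINT s|M. gap s)\<close> by (simp add: algebra_simps)
    then have "AE s in M. gap s = 0"
      using integral_nonneg_eq_0_iff_AE[OF gap_int] gap_nonneg by simp
    then show ?thesis
      by eventually_elim (rule norm_powr_split(2)[OF t p uc], simp add: gap_def)
  qed
qed

section \<open>Splitting along \<open>A\<close> and passage to classes\<close>

text \<open>At almost every point one summand is zero: on \<open>A\<close> the functions
  \<open>f\<close> and \<open>fA\<close> agree, off \<open>A\<close> both \<open>fA\<close> and
  \<open>z\<close> vanish.\<close>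

lemma integral_norm_powr_diff_split:
  assumes p: "1 < p" and A: "A \<in> sets M" and f: "f \<in> Lp_fun M p" and z: "z \<in> Lp_fun M p"
    and z0: "AE s in M. s \<notin> A \<longrightarrow> z s = 0"
    and fA_def: "fA = (\<lambda>s. if s \<in> A then f s else 0)"
  shows "(LINT s|M. norm (f s - z s) powr p)
    = (LINT s|M. norm (f s - fA s) powr p) + (LINT s|M. norm (fA s - z s) powr p)"
proof -
  have fA: "fA \<in> Lp_fun M p" unfolding fA_def using A f by (rule Lp_fun_restrict)
  note int = Lp_fun_integrable(1)[OF Lp_fun_diff[OF p]]
  note ints = int[OF f z] int[OF f fA] int[OF fA z]
  have "(LINT s|M. norm (f s - z s) powr p)
      = (LINT s|M. norm (f s - fA s) powr p + norm (fA s - z s) powr p)"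
  proof (rule integral_cong_AE)
    show "AE s in M. norm (f s - z s) powr p
        = norm (f s - fA s) powr p + norm (fA s - z s) powr p"
      using z0 by eventually_elim (simp add: fA_def)
  qed (use ints in \<open>auto intro!: borel_measurable_integrable\<close>)
  also have "\<dots> = (LINT s|M. norm (f s - fA s) powr p) + (LINT s|M. norm (fA s - z s) powr p)"
    using ints by simp
  finally show ?thesis .
qed

text \<open>Reduces the projection of a class to minimising the distance from \<open>fA\<close> over
  functions. In \<open>uniq\<close>, any competitor at least as near as \<open>c\<close> must agree
  with it almost everywhere, as the definite description demands.\<close>

lemma metric_projection_ball_on_class:
  fixes f c :: "'s \<Rightarrow> 'x::real_normed_vector"
  assumes p: "1 < p" and r: "0 < r" and A: "A \<in> sets M"
    and f: "f \<in> Lp_fun M p" and c: "c \<in> Lp_fun M p"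
    and fA_def: "fA = (\<lambda>s. if s \<in> A then f s else 0)"
    and c0: "AE s in M. s \<notin> A \<longrightarrow> c s = 0"
    and cr: "(LINT s|M. norm (c s) powr p) \<le> r powr p"
    and min: "\<And>z. z \<in> Lp_fun M p \<Longrightarrow> (LINT s|M. norm (z s) powr p) \<le> r powr p \<Longrightarrow>
      (LINT s|M. norm (fA s - c s) powr p) \<le> (LINT s|M. norm (fA s - z s) powr p)"
    and uniq: "\<And>z. z \<in> Lp_fun M p \<Longrightarrow> (LINT s|M. norm (z s) powr p) \<le> r powr p \<Longrightarrow>
      (LINT s|M. norm (fA s - z s) powr p) \<le> (LINT s|M. norm (fA s - c s) powr p) \<Longrightarrow>
      AE s in M. z s = c s"
  shows "metric_projection (Lp_dist M p) (ball_on M p A r) (Lp_eq M p `` {f}) = Lp_eq M p `` {c}"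
proof -
  note split = integral_norm_powr_diff_split[OF p A f _ _ fA_def]
  \<comment> \<open>The contribution of \<open>f - fA\<close> occurs on both sides and cancels once
    the p-th roots are removed.\<close>
  have dist_le: "Lp_dist M p (Lp_eq M p `` {f}) (Lp_eq M p `` {x})
        \<le> Lp_dist M p (Lp_eq M p `` {f}) (Lp_eq M p `` {y})
      \<longleftrightarrow> (LINT s|M. norm (fA s - x s) powr p) \<le> (LINT s|M. norm (fA s - y s) powr p)"
    if "x \<in> Lp_fun M p" "y \<in> Lp_fun M p"
      "AE s in M. s \<notin> A \<longrightarrow> x s = 0" "AE s in M. s \<notin> A \<longrightarrow> y s = 0" for x y
  proof -
    have "u powr (1 / p) \<le> v powr (1 / p) \<longleftrightarrow> u \<le> v" if "0 \<le> u" "0 \<le> v" for u v :: real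
      using that p powr_inverse_le_iff[of u "v powr (1 / p)" p] by (simp add: powr_powr)
    then show ?thesis
      using that p f by (simp add: Lp_dist_class) (simp add: split)
  qed
  have cB: "Lp_eq M p `` {c} \<in> ball_on M p A r"
    using class_in_ball_on_iff[OF p r c] c0 cr by simp
  have ball: "\<exists>z \<in> Lp_fun M p. d = Lp_eq M p `` {z} \<and> (AE s in M. s \<notin> A \<longrightarrow> z s = 0) \<and>
      (LINT s|M. norm (z s) powr p) \<le> r powr p" if dB: "d \<in> ball_on M p A r" for d
  proof -
    have "d \<in> Lp M p" using dB by (simp add: ball_on_def Lp_on_def)
    then obtain z where "z \<in> Lp_fun M p" "d = Lp_eq M p `` {z}"
      unfolding Lp_def by (rule quotientE)
    then show ?thesis using class_in_ball_on_iff[OF p r] dB by blast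
  qed
  show ?thesis unfolding metric_projection_def
  proof (rule the_equality)
    have "Lp_dist M p (Lp_eq M p `` {f}) (Lp_eq M p `` {c}) \<le> Lp_dist M p (Lp_eq M p `` {f}) d"
      if dB: "d \<in> ball_on M p A r" for d
    proof -
      obtain z where z: "z \<in> Lp_fun M p" "d = Lp_eq M p `` {z}"
        "AE s in M. s \<notin> A \<longrightarrow> z s = 0" "(LINT s|M. norm (z s) powr p) \<le> r powr p"
        using ball[OF dB] by blast
      show ?thesis
        unfolding z(2) using dist_le[OF c z(1) c0 z(3)] min[OF z(1,4)] by simp
    qed
    then show "Lp_eq M p `` {c} \<in> ball_on M p A r \<and> (\<forall>d\<in>ball_on M p A r.
        Lp_dist M p (Lp_eq M p `` {f}) (Lp_eq M p `` {c}) \<le> Lp_dist M p (Lp_eq M p `` {f}) d)"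
      using cB by blast
  next
    fix d assume d: "d \<in> ball_on M p A r \<and> (\<forall>e\<in>ball_on M p A r.
        Lp_dist M p (Lp_eq M p `` {f}) d \<le> Lp_dist M p (Lp_eq M p `` {f}) e)"
    obtain z where z: "z \<in> Lp_fun M p" "d = Lp_eq M p `` {z}"
      "AE s in M. s \<notin> A \<longrightarrow> z s = 0" "(LINT s|M. norm (z s) powr p) \<le> r powr p"
      using ball d by blast
    \<comment> \<open>Minimality of \<open>d\<close> is tested against the class of
      \<open>c\<close>.\<close>
    have "(LINT s|M. norm (fA s - z s) powr p) \<le> (LINT s|M. norm (fA s - c s) powr p)"
      using d cB dist_le[OF z(1) c z(3) c0] z(2) by simp
    then have "AE s in M. z s = c s" by (rule uniq[OF z(1,4)])
    then show "d = Lp_eq M p `` {c}" unfolding z(2) by (rule Lp_eq_class_eqI[OF z(1) c])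
  qed
qed

section \<open>Restriction and the projection formula\<close>

lemma restrict_in_Lp_on:
  assumes "A \<in> sets M" "g \<in> Lp M p"
  shows "Lp_restrict M p A g \<in> Lp_on M p A"
proof -
  obtain f where f: "f \<in> Lp_fun M p" "g = Lp_eq M p `` {f}"
    using assms(2) unfolding Lp_def by (rule quotientE)
  then show ?thesis
    using class_in_Lp_on_iff[OF Lp_fun_restrict[OF assms(1) f(1)]] Lp_restrict_class[OF assms(1) f(1)]
    by simp
qed

lemma restrict_eq_self:
  assumes "A \<in> sets M" "g \<in> Lp_on M p A"
  shows "Lp_restrict M p A g = g"
proof -
  have "g \<in> Lp M p" using assms by (simp add: Lp_on_def)
  then obtain f where f: "f \<in> Lp_fun M p" "g = Lp_eq M p `` {f}"
    unfolding Lp_def by (rule quotientE)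
  have "AE s in M. s \<notin> A \<longrightarrow> f s = 0"
    using assms f class_in_Lp_on_iff by blast
  then have "AE s in M. (if s \<in> A then f s else 0) = f s" by eventually_elim simp
  then show ?thesis
    unfolding f(2) Lp_restrict_class[OF assms(1) f(1)]
    by (rule Lp_eq_class_eqI[OF Lp_fun_restrict[OF assms(1) f(1)] f(1)])
qed

text \<open>A single formula covers all four cases: restrict to \<open>A\<close>, then shrink
  radially to norm \<open>r\<close> if the restriction lies outside the ball.\<close>

lemma metric_projection_ball_on:
  fixes g :: "('s \<Rightarrow> 'x::real_normed_vector) set"
  assumes uc: "uniformly_convex TYPE('x)" and p: "1 < p" and A: "A \<in> sets M" and r: "0 < r"
    and g: "g \<in> Lp M p"
  defines "gA \<equiv> Lp_restrict M p A g"
  shows "metric_projection (Lp_dist M p) (ball_on M p A r) g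
    = (if Lp_norm M p gA \<le> r then gA else Lp_scaleR M p (r / Lp_norm M p gA) gA)"
proof -
  obtain f where f: "f \<in> Lp_fun M p" and gf: "g = Lp_eq M p `` {f}"
    using g unfolding Lp_def by (rule quotientE)
  define fA where "fA = (\<lambda>s. if s \<in> A then f s else 0)"
  define F where "F = (LINT s|M. norm (fA s) powr p)"
  have fA: "fA \<in> Lp_fun M p" unfolding fA_def using A f by (rule Lp_fun_restrict)
  have gA: "gA = Lp_eq M p `` {fA}"
    unfolding gA_def gf fA_def using A f by (rule Lp_restrict_class)
  have norm_gA: "Lp_norm M p gA = F powr (1 / p)"
    using fA by (simp add: gA Lp_norm_class Lp_fun_integrable(2) F_def)
  have F0: "0 \<le> F" by (simp add: F_def)
  note proj = metric_projection_ball_on_class[OF p r A f _ fA_def, folded gf]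
  show ?thesis
  proof (cases "Lp_norm M p gA \<le> r")
    case True
    then have Fr: "F \<le> r powr p"
      using powr_inverse_le_iff[OF F0] r p by (simp add: norm_gA)
    have "metric_projection (Lp_dist M p) (ball_on M p A r) g = Lp_eq M p `` {fA}"
    proof (rule proj)
      \<comment> \<open>A competitor as near to \<open>fA\<close> as \<open>fA\<close> itself is at
        distance zero.\<close>
      fix z assume z: "z \<in> Lp_fun M p"
        and "(LINT s|M. norm (fA s - z s) powr p) \<le> (LINT s|M. norm (fA s - fA s) powr p)"
      then have "(LINT s|M. norm (fA s - z s) powr p) = 0"
        by (intro antisym) simp_all
      then have "AE s in M. norm (fA s - z s) powr p = 0"
        using integral_nonneg_eq_0_iff_AE[OF Lp_fun_integrable(1)[OF Lp_fun_diff[OF p fA z]]]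
        by simp
      then show "AE s in M. z s = fA s" by eventually_elim simp
    qed (use fA Fr in \<open>auto simp: fA_def F_def\<close>)
    then show ?thesis using True gA by simp
  next
    case False
    define t where "t = r / Lp_norm M p gA"
    have t: "0 < t" "t < 1"
      using False r by (auto simp: t_def)
    \<comment> \<open>The choice of \<open>t\<close> turns the ball constraint into the hypothesis
      of \<open>scaled_segment_nearest\<close>.\<close>
    have "t powr p * F = r powr p"
      using False r p F0 by (auto simp: t_def norm_gA powr_divide powr_powr)
    note tF = this[unfolded F_def]
    \<comment> \<open>The candidate attains the lower bound of
      \<open>scaled_segment_nearest\<close>.\<close>
    have scale: "(LINT s|M. norm (fA s - t *\<^sub>R fA s) powr p) = (1 - t) powr p * F"
    proof -
      have "norm (x - t *\<^sub>R x) powr p = (1 - t) powr p * norm x powr p" for x :: 'x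
      proof -
        have "x - t *\<^sub>R x = (1 - t) *\<^sub>R x" by (simp add: algebra_simps)
        then show ?thesis using t by (simp add: powr_mult)
      qed
      then show ?thesis by (simp add: F_def)
    qed
    have "metric_projection (Lp_dist M p) (ball_on M p A r) g = Lp_eq M p `` {\<lambda>s. t *\<^sub>R fA s}"
    proof (rule proj)
      show "(\<lambda>s. t *\<^sub>R fA s) \<in> Lp_fun M p" using fA by (rule Lp_fun_scaleR)
      show "AE s in M. s \<notin> A \<longrightarrow> t *\<^sub>R fA s = 0" by (simp add: fA_def)
      show "(LINT s|M. norm (t *\<^sub>R fA s) powr p) \<le> r powr p"
        using t by (simp add: powr_mult tF)
      fix z :: "'s \<Rightarrow> 'x"
      assume z: "z \<in> Lp_fun M p" "(LINT s|M. norm (z s) powr p) \<le> r powr p"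
      note near = scaled_segment_nearest[OF t p fA z(1), unfolded tF, OF z(2)]
      show "(LINT s|M. norm (fA s - t *\<^sub>R fA s) powr p) \<le> (LINT s|M. norm (fA s - z s) powr p)"
        using near(1) scale by (simp add: F_def)
      show "AE s in M. z s = t *\<^sub>R fA s"
        if "(LINT s|M. norm (fA s - z s) powr p) \<le> (LINT s|M. norm (fA s - t *\<^sub>R fA s) powr p)"
        using near(2)[OF uc] scale that by (simp add: F_def)
    qed
    also have "\<dots> = Lp_scaleR M p t gA" using fA by (simp add: gA Lp_scaleR_class)
    finally show ?thesis using False by (simp add: t_def)
  qed
qed

theorem theorem4p4:
  fixes M :: "'s measure"
    and p r :: real
    and A :: "'s set"
    and g :: "('s \<Rightarrow> 'x::banach) set"
  assumes "uniformly_convex TYPE('x)"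
    and "uniformly_smooth TYPE('x)"
    and "1 < p"
    and "A \<in> sets M"
    and "emeasure M A > 0"
    and "r > 0"
    and "g \<in> Lp M p"
  shows "(g \<in> ball_on M p A r \<longrightarrow>
            metric_projection (Lp_dist M p) (ball_on M p A r) g = g) \<and>
         (g \<in> Lp_on M p A - ball_on M p A r \<longrightarrow>
            metric_projection (Lp_dist M p) (ball_on M p A r) g =
              Lp_scaleR M p (r / Lp_norm M p g) g) \<and>
         (g \<in> cylinder_on M p A r - Lp_on M p A \<longrightarrow>
            metric_projection (Lp_dist M p) (ball_on M p A r) g = Lp_restrict M p A g) \<and>
         (g \<in> Lp M p - (cylinder_on M p A r \<union> Lp_on M p A) \<longrightarrow>
            metric_projection (Lp_dist M p) (ball_on M p A r) g =
              Lp_scaleR M p (r / Lp_norm M p (Lp_restrict M p A g)) (Lp_restrict M p A g))"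
proof -
  note proj = metric_projection_ball_on[OF assms(1,3,4,6,7)]
  have self: "Lp_restrict M p A g = g" if "g \<in> Lp_on M p A"
    using restrict_eq_self[OF assms(4) that] .
  have ball: "g \<in> ball_on M p A r \<longleftrightarrow> g \<in> Lp_on M p A \<and> Lp_norm M p g \<le> r"
    by (simp add: ball_on_def)
  \<comment> \<open>The restriction always lies in \<open>Lp_on M p A\<close>, so only the norm
    bound remains.\<close>
  have cylinder: "g \<in> cylinder_on M p A r \<longleftrightarrow> Lp_norm M p (Lp_restrict M p A g) \<le> r"
    using assms(7) restrict_in_Lp_on[OF assms(4,7)] by (simp add: cylinder_on_def ball_on_def)
  \<comment> \<open>Each case fixes the branch of \<open>proj\<close>; for classes in
    \<open>Lp_on M p A\<close>, \<open>self\<close> replaces the restriction by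
    \<open>g\<close>.\<close>
  show ?thesis
    unfolding proj cylinder Diff_iff Un_iff ball using self by (intro conjI impI) simp_all
qed

end
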